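(* If $\diamondsuit(\mathfrak{b})$ holds, then there is a pseudocompact MAD family of size $\omega_1$, i.e. a MAD family $\mathcal A$ on $\omega$ with $|\mathcal A|=\omega_1$ such that the Vietoris hyperspace $\exp(\Psi(\mathcal A))$ is a pseudocompact space.
   Context: An almost disjoint family (on $\omega$) is an infinite set $\mathcal A$ of infinite subsets of $\omega$ such that $a\cap b$ is finite for all distinct $a,b\in\mathcal A$. A MAD family is an almost disjoint family not properly contained in any other almost disjoint family. $\Psi(\mathcal A)$ is the set $\omega\cup\mathcal A$ with the topology having base $\{\{n\}:n\in\omega\}\cup\{\{a\}\cup(a\setminus F): a\in\mathcal A,\ F\in[\omega]^{<\omega}\}$. For a $T_1$ space $X$, $\exp(X)$ is the set of all nonempty closed subsets of $X$ with the Vietoris topology, generated by the subbase of all sets $U^+=\{F\in\exp(X):F\subseteq U\}$ and $U^-=\{F\in\exp(X):F\cap U\ne\emptyset\}$ with $U\subseteq X$ open. A space is pseudocompact if every continuous real-valued function on it is bounded. An almost disjoint family $\mathcal A$ is called pseudocompact if $\exp(\Psi(\mathcal A))$ is pseudocompact. For $f,g\in\omega^\omega$, $f\geq^* g$ means $f(n)\geq g(n)$ for all but finitely many $n$. A function $F:2^{<\omega_1}\to\omega^\omega$ is Borel if for every $\delta<\omega_1$ the restriction of $F$ to $2^\delta$ is a Borel map. The principle $\diamondsuit(\mathfrak b)$ is the statement: for every Borel $F:2^{<\omega_1}\to\omega^\omega$ there exists $g:\omega_1\to\omega^\omega$ such that for every $f\in 2^{\omega_1}$ the set $\{\alpha\in\omega_1: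 F(f\upharpoonright\alpha)\not\geq^* g(\alpha)\}$ is stationary in $\omega_1$. *)

theory Defs
  imports "HOL-Analysis.Analysis" "HOL-Library.Equipollence" "HOL-Library.Countable_Set_Type"
begin

section \<open>The ordinal $\omega_1$\<close>

text \<open>
  The first uncountable ordinal, as the cardinal successor of \<open>natLeq\<close>, which is a well-order
  of least possible type.  As usual, \<open>\<delta>\<close> is identified with its set of predecessors
  \<open>{..<\<delta>}\<close>.  The lemmas below say that \<open>\<omega>\<^sub>1\<close> is an uncountable well-order all of whose proper
  initial segments are countable, which determines it up to isomorphism.
\<close>

typedef omega1 = "Field (cardSuc natLeq)"
proof -
  have "\<not> finite (Field (cardSuc natLeq))"
    using cardSuc_finite[OF natLeq_Card_order] by (simp add: Field_natLeq)
  then show ?thesis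
    by (metis ex_in_conv finite.emptyI)
qed

instantiation omega1 :: wellorder
begin

definition less_eq_omega1 :: "omega1 \<Rightarrow> omega1 \<Rightarrow> bool" where
  "x \<le> y \<longleftrightarrow> (Rep_omega1 x, Rep_omega1 y) \<in> cardSuc natLeq"

definition less_omega1 :: "omega1 \<Rightarrow> omega1 \<Rightarrow> bool" where
  "x < y \<longleftrightarrow> x \<le> y \<and> x \<noteq> (y :: omega1)"

instance
proof -
  have "Well_order (cardSuc natLeq)"
    using cardSuc_Card_order[OF natLeq_Card_order] by (simp add: card_order_on_def)
  then have lin: "Linear_order (cardSuc natLeq)" and wf: "wf (cardSuc natLeq - Id)"
    by (auto simp: well_order_on_def)
  have refl: "refl_on (Field (cardSuc natLeq)) (cardSuc natLeq)"
    and trans: "trans (cardSuc natLeq)" and antisym: "antisym (cardSuc natLeq)"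
    and total: "total_on (Field (cardSuc natLeq)) (cardSuc natLeq)"
    using lin by (auto simp: order_on_defs)
  show "OFCLASS(omega1, wellorder_class)"
  proof
    fix x y z :: omega1
    show le_refl: "x \<le> x"
      using refl Rep_omega1[of x] by (auto simp: less_eq_omega1_def refl_on_def)
    show "x \<le> z" if "x \<le> y" "y \<le> z"
      using that trans unfolding less_eq_omega1_def by (meson transD)
    show eq: "x = y" if "x \<le> y" "y \<le> x"
      using that antisym unfolding less_eq_omega1_def by (meson Rep_omega1_inject antisymD)
    show "(x < y) = (x \<le> y \<and> \<not> y \<le> x)"
      using le_refl eq unfolding less_omega1_def by blast
    show "x \<le> y \<or> y \<le> x"
      using total Rep_omega1[of x] Rep_omega1[of y] le_refl unfolding less_eq_omega1_def total_on_def
      by (metis Rep_omega1_inject)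
  next
    fix P :: "omega1 \<Rightarrow> bool" and a :: omega1
    assume step: "\<And>x. (\<And>y. y < x \<Longrightarrow> P y) \<Longrightarrow> P x"
    have "{(x, y). x < y} \<subseteq> inv_image (cardSuc natLeq - Id) Rep_omega1"
      by (auto simp: less_omega1_def less_eq_omega1_def inv_image_def Rep_omega1_inject)
    then have "wf {(x :: omega1, y). x < y}"
      using wf_subset[OF wf_inv_image[OF wf]] by blast
    then show "P a"
      by (induction a rule: wf_induct_rule) (auto intro: step)
  qed
qed

end

lemma uncountable_omega1:
  includes cardinal_syntax
  shows "uncountable (UNIV :: omega1 set)"
proof
  assume "countable (UNIV :: omega1 set)"
  then have "countable (range Rep_omega1)"
    by blast
  then have "|Field (cardSuc natLeq)| \<le>o natLeq"
    using countable_card_le_natLeq type_definition.Rep_range[OF type_definition_omega1] by auto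
  then have "cardSuc natLeq \<le>o natLeq"
    using card_of_Field_ordIso[OF cardSuc_Card_order[OF natLeq_Card_order]]
    by (meson ordIso_ordLeq_trans ordIso_symmetric)
  then show False
    using cardSuc_greater[OF natLeq_Card_order] not_ordLess_ordLeq by blast
qed

lemma countable_lessThan_omega1:
  includes cardinal_syntax
  shows "countable {..<\<delta> :: omega1}"
proof -
  have "|underS (cardSuc natLeq) (Rep_omega1 \<delta>)| <o cardSuc natLeq"
    using cardSuc_Card_order[OF natLeq_Card_order] Rep_omega1 by (rule card_of_underS)
  then have "countable (underS (cardSuc natLeq) (Rep_omega1 \<delta>))"
    using cardSuc_ordLeq_ordLess[OF natLeq_Card_order card_of_Card_order] countable_card_le_natLeq
    by blast
  moreover have "Rep_omega1 ` {..<\<delta>} \<subseteq> underS (cardSuc natLeq) (Rep_omega1 \<delta>)"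
    by (auto simp: underS_def less_omega1_def less_eq_omega1_def Rep_omega1_inject)
  ultimately show ?thesis
    by (meson Rep_omega1_inject countable_image_inj_on countable_subset inj_onI)
qed

definition club :: "omega1 set \<Rightarrow> bool" where
  "club C \<longleftrightarrow> (\<forall>\<alpha>. \<exists>\<beta>\<in>C. \<alpha> < \<beta>) \<and>
     (\<forall>\<delta>. {..<\<delta>} \<noteq> {} \<and> (\<forall>\<alpha><\<delta>. \<exists>\<beta>\<in>C. \<alpha> < \<beta> \<and> \<beta> < \<delta>) \<longrightarrow> \<delta> \<in> C)"

definition stationary :: "omega1 set \<Rightarrow> bool" where
  "stationary S \<longleftrightarrow> (\<forall>C. club C \<longrightarrow> S \<inter> C \<noteq> {})"


section \<open>The parametrized diamond principle for $\mathfrak b$\<close>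

definition ge_star :: "(nat \<Rightarrow> nat) \<Rightarrow> (nat \<Rightarrow> nat) \<Rightarrow> bool" (infix \<open>\<ge>\<^sup>*\<close> 50) where
  "f \<ge>\<^sup>* g \<longleftrightarrow> finite {n. \<not> f n \<ge> g n}"

text \<open>$2^\delta$ with the product topology; its points are extensional functions on \<open>{..<\<delta>}\<close>.\<close>

definition Cantor_pow :: "omega1 \<Rightarrow> (omega1 \<Rightarrow> bool) topology" where
  "Cantor_pow \<delta> = product_topology (\<lambda>_. discrete_topology UNIV) {..<\<delta>}"

definition borel_of :: "'a topology \<Rightarrow> 'a measure" where
  "borel_of X = sigma (topspace X) {U. openin X U}"

text \<open>
  A function on $2^{<\omega_1}$ is represented by the family \<open>F\<close> of its restrictions to the
  (pairwise disjoint) sets $2^\delta$: the value at \<open>s\<close> in $2^\delta$ is \<open>F \<delta> s\<close>.  The explicit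
  length is needed because an extensional function may be extensional on several \<open>{..<\<delta>}\<close>.
  The values of \<open>F \<delta>\<close> outside $2^\delta$ are irrelevant.  The Borel structure on
  \<open>nat \<Rightarrow> nat\<close> is that of the product topology.
\<close>

definition Borel_fun :: "(omega1 \<Rightarrow> (omega1 \<Rightarrow> bool) \<Rightarrow> (nat \<Rightarrow> nat)) \<Rightarrow> bool" where
  "Borel_fun F \<longleftrightarrow> (\<forall>\<delta>. F \<delta> \<in> borel_of (Cantor_pow \<delta>) \<rightarrow>\<^sub>M borel)"

definition diamond_b :: bool where
  "diamond_b \<longleftrightarrow>
     (\<forall>F. Borel_fun F \<longrightarrow>
       (\<exists>g :: omega1 \<Rightarrow> (nat \<Rightarrow> nat). \<forall>f :: omega1 \<Rightarrow> bool.
          stationary {\<alpha>. \<not> F \<alpha> (restrict f {..<\<alpha>}) \<ge>\<^sup>* g \<alpha>}))"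


section \<open>Almost disjoint families and their $\Psi$-spaces\<close>

definition almost_disjoint_family :: "nat set set \<Rightarrow> bool" where
  "almost_disjoint_family A \<longleftrightarrow>
     infinite A \<and> (\<forall>a\<in>A. infinite a) \<and> (\<forall>a\<in>A. \<forall>b\<in>A. a \<noteq> b \<longrightarrow> finite (a \<inter> b))"

definition MAD_family :: "nat set set \<Rightarrow> bool" where
  "MAD_family A \<longleftrightarrow>
     almost_disjoint_family A \<and> \<not> (\<exists>B. almost_disjoint_family B \<and> A \<subset> B)"

definition Psi_base :: "nat set set \<Rightarrow> (nat + nat set) set set" where
  "Psi_base A = {{Inl n} | n. True} \<union>
     {insert (Inr a) (Inl ` (a - F)) | a F. a \<in> A \<and> finite F}"

definition Psi :: "nat set set \<Rightarrow> (nat + nat set) topology" where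
  "Psi A = topology_generated_by (Psi_base A)"

lemma topspace_Psi: "topspace (Psi A) = range Inl \<union> Inr ` A"
proof
  show "topspace (Psi A) \<subseteq> range Inl \<union> Inr ` A"
    by (auto simp: Psi_def Psi_base_def)
  have "insert (Inr a) (Inl ` (a - {})) \<in> Psi_base A" if "a \<in> A" for a
    using that by (auto simp: Psi_base_def)
  moreover have "{Inl n} \<in> Psi_base A" for n
    by (simp add: Psi_base_def)
  ultimately show "range Inl \<union> Inr ` A \<subseteq> topspace (Psi A)"
    unfolding Psi_def topology_generated_by_topspace by blast
qed

text \<open>\<open>Psi_base A\<close> is indeed a base, and not only a subbase, of \<open>Psi A\<close>.\<close>

lemma openin_Psi_iff: "openin (Psi A) U \<longleftrightarrow> (\<forall>x\<in>U. \<exists>B\<in>Psi_base A. x \<in> B \<and> B \<subseteq> U)"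
proof
  assume "openin (Psi A) U"
  then have "generate_topology_on (Psi_base A) U"
    by (simp add: Psi_def openin_topology_generated_by_iff)
  then show "\<forall>x\<in>U. \<exists>B\<in>Psi_base A. x \<in> B \<and> B \<subseteq> U"
  proof induction
    case (Int U V)
    show ?case
    proof
      fix x assume x: "x \<in> U \<inter> V"
      show "\<exists>B\<in>Psi_base A. x \<in> B \<and> B \<subseteq> U \<inter> V"
      proof (cases x)
        case (Inl n)
        then show ?thesis
          using x by (intro bexI[of _ "{Inl n}"]) (auto simp: Psi_base_def)
      next
        case (Inr a)
        obtain B where B: "B \<in> Psi_base A" "x \<in> B" "B \<subseteq> U"
          using Int.IH(1) x by blast
        obtain C where C: "C \<in> Psi_base A" "x \<in> C" "C \<subseteq> V"
          using Int.IH(2) x by blast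
        obtain F where F: "B = insert (Inr a) (Inl ` (a - F))" "finite F" "a \<in> A"
          using B Inr by (auto simp: Psi_base_def)
        obtain G where G: "C = insert (Inr a) (Inl ` (a - G))" "finite G"
          using C Inr by (auto simp: Psi_base_def)
        have "insert (Inr a) (Inl ` (a - (F \<union> G))) \<in> Psi_base A"
          using F G by (auto simp: Psi_base_def)
        moreover have "insert (Inr a) (Inl ` (a - (F \<union> G))) \<subseteq> B \<inter> C"
          unfolding F(1) G(1) by auto
        ultimately show ?thesis
          unfolding Inr using B(3) C(3) by (meson Int_mono insertI1 order_trans)
      qed
    qed
  next
    case Empty
    then show ?case
      by simp
  next
    case (UN K)
    show ?case
    proof
      fix x assume "x \<in> \<Union>K"
      then obtain U where "U \<in> K" "x \<in> U" ..
      with UN.IH[of U] show "\<exists>B\<in>Psi_base A. x \<in> B \<and> B \<subseteq> \<Union>K"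
        by (meson Union_upper order_trans)
    qed
  next
    case (Basis B)
    then show ?case
      by auto
  qed
next
  assume "\<forall>x\<in>U. \<exists>B\<in>Psi_base A. x \<in> B \<and> B \<subseteq> U"
  then show "openin (Psi A) U"
  unfolding openin_subopen[of _ U] Psi_def by (meson topology_generated_by_Basis)
qed


section \<open>Vietoris hyperspaces and pseudocompactness\<close>

definition exp_upper :: "'a topology \<Rightarrow> 'a set \<Rightarrow> 'a set set" where
  "exp_upper X U = {F. closedin X F \<and> F \<noteq> {} \<and> F \<subseteq> U}"

definition exp_lower :: "'a topology \<Rightarrow> 'a set \<Rightarrow> 'a set set" where
  "exp_lower X U = {F. closedin X F \<and> F \<noteq> {} \<and> F \<inter> U \<noteq> {}}"

definition Vietoris :: "'a topology \<Rightarrow> 'a set topology" where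
  "Vietoris X = topology_generated_by
     ({exp_upper X U | U. openin X U} \<union> {exp_lower X U | U. openin X U})"

lemma topspace_Vietoris: "topspace (Vietoris X) = {F. closedin X F \<and> F \<noteq> {}}"
proof
  show "topspace (Vietoris X) \<subseteq> {F. closedin X F \<and> F \<noteq> {}}"
    by (auto simp: Vietoris_def exp_upper_def exp_lower_def)
  have "{F. closedin X F \<and> F \<noteq> {}} = exp_upper X (topspace X)"
    by (auto simp: exp_upper_def dest: closedin_subset)
  then show "{F. closedin X F \<and> F \<noteq> {}} \<subseteq> topspace (Vietoris X)"
    using openin_topspace[of X] unfolding Vietoris_def topology_generated_by_topspace by blast
qed

definition pseudocompact_space :: "'a topology \<Rightarrow> bool" where
  "pseudocompact_space X \<longleftrightarrow>
     (\<forall>f. continuous_map X euclideanreal f \<longrightarrow> bounded (f ` topspace X))"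

definition pseudocompact_family :: "nat set set \<Rightarrow> bool" where
  "pseudocompact_family A \<longleftrightarrow> pseudocompact_space (Vietoris (Psi A))"

end

theory Submission
  imports Defs
begin

text \<open>
  The family \<open>a \<alpha>\<close> is built by recursion on \<open>\<alpha> < \<omega>\<^sub>1\<close>: a function \<open>g \<alpha>\<close> supplied by
  \<open>\<diamond>(\<b>)\<close> together with an enumeration \<open>b\<^sub>0, b\<^sub>1, \<dots>\<close> of \<open>{a \<beta> | \<beta> < \<alpha>}\<close> yields the union over \<open>k\<close>
  of the sets \<open>[0, g \<alpha> k) - (b\<^sub>0 \<union> \<dots> \<union> b\<^sub>k)\<close>, which is almost disjoint from every \<open>b\<^sub>i\<close>.

  Since \<open>\<omega>\<close> is dense in \<open>\<Psi>(\<A>)\<close>, the finite nonempty subsets of \<open>\<omega>\<close> are dense in the hyperspace,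
  so it suffices that every sequence \<open>D\<close> of such sets has a \<open>p\<close>-limit \<open>K\<close> for some free ultrafilter
  \<open>p\<close>.  Given \<open>D\<close>, let \<open>S\<close> be the greedy set of all \<open>\<alpha>\<close> such that the sets
  \<open>{n. D n \<inter> a \<beta> - [0, m) \<noteq> \<emptyset>}\<close> for \<open>\<beta> \<in> S \<inter> \<alpha>\<close> or \<open>\<beta> = \<alpha>\<close>, together with the cofinite sets, have the
  finite intersection property.  Let \<open>p\<close> be an ultrafilter containing all these sets for \<open>\<beta> \<in> S\<close>, and
  let \<open>K\<close> consist of the \<open>a \<alpha>\<close> with \<open>\<alpha> \<in> S\<close> and of the \<open>x \<in> \<omega>\<close> lying in \<open>p\<close>-many \<open>D n\<close>.  If \<open>K \<subseteq> U\<close> with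
  \<open>U\<close> open, but \<open>p\<close>-many \<open>D n\<close> are not contained in \<open>W = U \<inter> \<omega>\<close>, then for every \<open>\<alpha>\<close> the sets
  \<open>D n - W\<close> leave any finite union of sets \<open>a \<beta>\<close> with \<open>\<beta> < \<alpha>\<close>.  By the guessing principle applied to a code
  of \<open>a, S, D, W\<close>, some \<open>a \<alpha>\<close> meets infinitely many of them, compatibly with the sets required for
  \<open>S \<inter> \<alpha>\<close>.  Then \<open>\<alpha> \<in> S\<close> although \<open>a \<alpha> - W\<close> is infinite, which contradicts \<open>a \<alpha> \<in> K \<subseteq> U\<close>.
\<close>

section \<open>Ultrafilters and greedy subsets of a well-order\<close>

text \<open>Zorn's lemma gives a minimal proper filter \<open>p\<close> below \<open>F\<close>. If
  \<open>p\<close> restricted to \<open>P\<close> is still proper, minimality makes it equal to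
  \<open>p\<close>, so \<open>P\<close> holds eventually; otherwise the negation of \<open>P\<close>
  does.\<close>

lemma ultrafilter_below:
  fixes F :: "'a filter"
  assumes "F \<noteq> bot"
  shows "\<exists>p. p \<le> F \<and> p \<noteq> bot \<and> (\<forall>P. eventually P p \<or> eventually (\<lambda>x. \<not> P x) p)"
proof -
  let ?A = "{G. G \<le> F \<and> G \<noteq> bot}"
  have "\<exists>m\<in>?A. \<forall>a\<in>?A. m \<ge> a \<longrightarrow> a = m"
  proof (rule predicate_Zorn)
    show "partial_order_on ?A (relation_of (\<lambda>x y. x \<ge> y) ?A)"
      by (auto simp: partial_order_on_def preorder_on_def refl_on_def trans_def antisym_def relation_of_def)
    fix C assume C: "C \<in> Chains (relation_of (\<lambda>x y. x \<ge> y) ?A)"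
    then have sub: "C \<subseteq> ?A" and tot: "\<And>G H. G \<in> C \<Longrightarrow> H \<in> C \<Longrightarrow> G \<le> H \<or> H \<le> G"
      unfolding Chains_def relation_of_def by auto
    show "\<exists>u\<in>?A. \<forall>a\<in>C. a \<ge> u"
    proof (cases "C = {}")
      case True
      then show ?thesis
        using assms by blast
    next
      case False
      \<comment> \<open>A nonempty chain is a filter base, so its infimum is improper only if some
        member is.\<close>
      have "eventually (\<lambda>_. False) (Inf C) \<longleftrightarrow> (\<exists>G\<in>C. eventually (\<lambda>_. False) G)"
        by (rule eventually_Inf_base) (use False tot in \<open>auto simp: inf_absorb1 inf_absorb2\<close>)
      then have "Inf C \<noteq> bot"
        using sub by (auto simp: trivial_limit_def)
      moreover from False obtain G where "G \<in> C"
        by blast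
      then have "Inf C \<le> F"
        using Inf_lower[of G C] sub order_trans by blast
      ultimately show ?thesis
        by (auto intro: Inf_lower)
    qed
  qed
  then obtain p where p: "p \<le> F" "p \<noteq> bot" and max: "\<And>q. q \<noteq> bot \<Longrightarrow> q \<le> p \<Longrightarrow> q = p"
    by (auto intro: order_trans)
  have "eventually P p \<or> eventually (\<lambda>x. \<not> P x) p" for P
  proof (cases "inf p (principal {x. P x}) = bot")
    case True
    then show ?thesis
      by (auto simp: trivial_limit_def eventually_inf_principal)
  next
    case False
    then have "inf p (principal {x. P x}) = p"
      by (intro max) auto
    then have "p \<le> principal {x. P x}"
      by (metis inf.cobounded2)
    then show ?thesis
      by (simp add: le_principal)
  qed
  with p show ?thesis
    by blast
qed

text \<open>Well-founded recursion decides each \<alpha> from the decisions already made below it.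
  Later \<open>Q\<close> expresses that a filter is proper.\<close>

lemma wellorder_greedy_set:
  fixes Q :: "'a::wellorder set \<Rightarrow> bool"
  shows "\<exists>S. \<forall>\<alpha>. \<alpha> \<in> S \<longleftrightarrow> Q (insert \<alpha> (S \<inter> {..<\<alpha>}))"
proof -
  define h where "h = wfrec {(x::'a, y). x < y} (\<lambda>h \<alpha>. Q (insert \<alpha> {\<beta>. \<beta> < \<alpha> \<and> h \<beta>}))"
  have "h \<alpha> \<longleftrightarrow> Q (insert \<alpha> {\<beta>. \<beta> < \<alpha> \<and> h \<beta>})" for \<alpha>
  proof -
    have "h \<alpha> \<longleftrightarrow> Q (insert \<alpha> {\<beta>. \<beta> < \<alpha> \<and> cut h {(x, y). x < y} \<alpha> \<beta>})"
      unfolding h_def by (subst wfrec[OF wf]) (rule refl)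
    moreover have "{\<beta>. \<beta> < \<alpha> \<and> cut h {(x, y). x < y} \<alpha> \<beta>} = {\<beta>. \<beta> < \<alpha> \<and> h \<beta>}"
      by (auto simp: cut_def)
    ultimately show ?thesis
      by simp
  qed
  moreover have "Collect h \<inter> {..<\<alpha>} = {\<beta>. \<beta> < \<alpha> \<and> h \<beta>}" for \<alpha>
    by auto
  ultimately have "\<alpha> \<in> Collect h \<longleftrightarrow> Q (insert \<alpha> (Collect h \<inter> {..<\<alpha>}))" for \<alpha>
    unfolding mem_Collect_eq by metis
  then show ?thesis
    by blast
qed

section \<open>Guessing sequences of subsets\<close>

lemma countable_bounded_omega1:
  fixes X :: "omega1 set"
  assumes "countable X"
  shows "\<exists>\<gamma>. \<forall>x\<in>X. x < \<gamma>"
proof -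
  have "countable (\<Union>x\<in>X. insert x {..<x})"
    using assms countable_lessThan_omega1 by auto
  then obtain \<gamma> where "\<gamma> \<notin> (\<Union>x\<in>X. insert x {..<x})"
    using uncountable_omega1 by (metis UNIV_eq_I)
  then have "\<forall>x\<in>X. x < \<gamma>"
    by (auto simp: not_less less_le)
  then show ?thesis ..
qed

text \<open>For unboundedness, a function \<open>h\<close> that dominates \<open>c\<close> is
  iterated countably often and the supremum is taken.\<close>

lemma club_closed_under:
  fixes c :: "omega1 \<Rightarrow> 'c::countable \<Rightarrow> omega1"
  shows "club {\<alpha>. infinite {..<\<alpha>} \<and> (\<forall>\<beta><\<alpha>. \<forall>j. c \<beta> j < \<alpha>)}" (is "club ?C")
  unfolding club_def
proof (intro conjI allI impI)
  fix \<alpha> :: omega1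
  have "\<exists>\<gamma>. \<alpha> < \<gamma> \<and> (\<forall>\<beta>\<le>\<alpha>. \<forall>j. c \<beta> j < \<gamma>)" for \<alpha>
  proof -
    have "{..\<alpha>} = insert \<alpha> {..<\<alpha>}"
      by auto
    then have "countable (insert \<alpha> (\<Union>\<beta>\<in>{..\<alpha>}. range (c \<beta>)))"
      using countable_lessThan_omega1[of \<alpha>] by auto
    from countable_bounded_omega1[OF this] obtain \<gamma> where
      "\<forall>x \<in> insert \<alpha> (\<Union>\<beta>\<in>{..\<alpha>}. range (c \<beta>)). x < \<gamma>" ..
    then show ?thesis
      by blast
  qed
  then obtain h where h: "\<And>\<alpha>. \<alpha> < h \<alpha>" "\<And>\<alpha> \<beta> j. \<beta> \<le> \<alpha> \<Longrightarrow> c \<beta> j < h \<alpha>"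
    by metis
  define s where "s n = (h ^^ n) \<alpha>" for n
  have s: "s 0 = \<alpha>" "s (Suc n) = h (s n)" for n
    by (simp_all add: s_def)
  have mono: "strict_mono s"
    by (simp add: strict_mono_Suc_iff s h)
  \<comment> \<open>Leastness puts every \<beta> < \<delta> below some \<open>s n\<close>, which is
    what closure under \<open>c\<close> requires.\<close>
  define \<delta> where "\<delta> = (LEAST \<delta>. \<forall>n. s n < \<delta>)"
  have "countable (range s)"
    by simp
  from countable_bounded_omega1[OF this] obtain \<gamma> where "\<forall>n. s n < \<gamma>"
    by auto
  then have "\<forall>n. s n < \<delta>"
    unfolding \<delta>_def by (rule LeastI)
  then have \<delta>: "s n < \<delta>" for n
    by simp
  have "range s \<subseteq> {..<\<delta>}"
    using \<delta> by auto
  then have "infinite {..<\<delta>}"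
    using range_inj_infinite[OF strict_mono_imp_inj_on[OF mono]] by (rule infinite_super)
  moreover have "c \<beta> j < \<delta>" if "\<beta> < \<delta>" for \<beta> j
  proof -
    obtain n where "\<beta> \<le> s n"
      using not_less_Least[of \<beta> "\<lambda>\<delta>. \<forall>n. s n < \<delta>"] \<open>\<beta> < \<delta>\<close>
      unfolding \<delta>_def[symmetric] by (auto simp: not_less)
    then show ?thesis
      using h(2)[of \<beta> "s n" j] \<delta>[of "Suc n"] by (simp add: s)
  qed
  ultimately show "\<exists>\<beta>\<in>?C. \<alpha> < \<beta>"
    using \<delta>[of 0] s by auto
next
  fix \<delta> :: omega1
  assume "{..<\<delta>} \<noteq> {} \<and> (\<forall>\<alpha><\<delta>. \<exists>\<beta>\<in>?C. \<alpha> < \<beta> \<and> \<beta> < \<delta>)"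
  then have ne: "{..<\<delta>} \<noteq> {}" and *: "\<And>\<alpha>. \<alpha> < \<delta> \<Longrightarrow> \<exists>\<beta>\<in>?C. \<alpha> < \<beta> \<and> \<beta> < \<delta>"
    by blast+
  from ne obtain \<alpha> where "\<alpha> < \<delta>"
    by blast
  with * obtain \<beta> where "\<beta> \<in> ?C" "\<beta> < \<delta>"
    by blast
  then have "{..<\<beta>} \<subseteq> {..<\<delta>}" "infinite {..<\<beta>}"
    by auto
  then have "infinite {..<\<delta>}"
    by (rule infinite_super)
  moreover have "c \<alpha> j < \<delta>" if "\<alpha> < \<delta>" for \<alpha> j
  proof -
    from *[OF that] obtain \<beta> where "\<beta> \<in> ?C" "\<alpha> < \<beta>" "\<beta> < \<delta>"
      by blast
    then have "c \<alpha> j < \<beta>"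
      by simp
    then show ?thesis
      using \<open>\<beta> < \<delta>\<close> by (rule less_trans)
  qed
  ultimately show "\<delta> \<in> ?C"
    by blast
qed

text \<open>An infinite cardinal absorbs a countable factor. The injection serves to code a sequence
  of subsets of a countable type, indexed by \<open>omega1\<close>, as one subset of
  \<open>omega1\<close>.\<close>

lemma inj_omega1_pairs:
  obtains c :: "omega1 \<times> 'c::countable \<Rightarrow> omega1" where "inj c"
proof -
  include cardinal_syntax
  have inf: "infinite (UNIV :: omega1 set)"
    using uncountable_omega1 by (rule uncountable_infinite)
  have "|UNIV :: 'c set| \<le>o natLeq"
    using countableI_type[of "UNIV :: 'c set"] by (simp only: countable_card_le_natLeq)
  moreover have "natLeq \<le>o |UNIV :: omega1 set|"
    using inf infinite_iff_natLeq_ordLeq by blast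
  ultimately have "|UNIV :: 'c set| \<le>o |UNIV :: omega1 set|"
    by (rule ordLeq_transitive)
  then have "|(UNIV :: omega1 set) \<times> (UNIV :: 'c set)| \<le>o |UNIV :: omega1 set|"
    by (rule ordIso_imp_ordLeq[OF conjunct1[OF card_of_Times_infinite[OF inf UNIV_not_empty]]])
  then have "\<exists>c. inj_on c ((UNIV :: omega1 set) \<times> (UNIV :: 'c set)) \<and> range c \<subseteq> (UNIV :: omega1 set)"
    by (simp only: card_of_ordLeq[symmetric] UNIV_Times_UNIV)
  then show ?thesis
    using that by auto
qed

lemma measurable_Cantor_pow_component:
  assumes "\<gamma> < \<delta>"
  shows "(\<lambda>s. s \<gamma>) \<in> borel_of (Cantor_pow \<delta>) \<rightarrow>\<^sub>M count_space UNIV"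
proof (rule measurableI)
  fix B :: "bool set"
  have "openin (Cantor_pow \<delta>) {s \<in> topspace (Cantor_pow \<delta>). s \<gamma> \<in> B}"
    unfolding Cantor_pow_def
    by (rule openin_continuous_map_preimage[OF continuous_map_product_projection]) (use assms in auto)
  moreover have "{U. openin (Cantor_pow \<delta>) U} \<subseteq> Pow (topspace (Cantor_pow \<delta>))"
    using openin_subset by blast
  moreover have "(\<lambda>s. s \<gamma>) -` B \<inter> topspace (Cantor_pow \<delta>) = {s \<in> topspace (Cantor_pow \<delta>). s \<gamma> \<in> B}"
    by auto
  ultimately show "(\<lambda>s. s \<gamma>) -` B \<inter> space (borel_of (Cantor_pow \<delta>)) \<in> sets (borel_of (Cantor_pow \<delta>))"
    by (simp add: borel_of_def)
qed auto

text \<open>A code \<open>f\<close> of the whole sequence \<open>x\<close> is fed to the diamond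
  principle. On the club of closure points of the coding, \<open>f\<close> restricted to \<alpha>
  already determines all terms of \<open>x\<close> below \<alpha>, and the stationary set of good
  guesses meets that club.\<close>

lemma diamond_b_guess:
  fixes G :: "(nat \<times> 'c::countable \<Rightarrow> bool) \<Rightarrow> nat \<Rightarrow> nat"
  assumes "diamond_b"
    and meas: "\<And>k. (\<lambda>y. G y k) \<in> PiM UNIV (\<lambda>_. count_space UNIV) \<rightarrow>\<^sub>M count_space UNIV"
  shows "\<exists>g. \<forall>x :: omega1 \<Rightarrow> 'c \<Rightarrow> bool. \<exists>\<alpha>. infinite {..<\<alpha>} \<and>
    infinite {k. G (\<lambda>(i, j). x (from_nat_into {..<\<alpha>} i) j) k < g \<alpha> k}"
proof -
  obtain c :: "omega1 \<times> 'c \<Rightarrow> omega1" where c: "inj c"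
    by (rule inj_omega1_pairs)
  define C where "C = {\<alpha>. infinite {..<\<alpha>} \<and> (\<forall>\<beta><\<alpha>. \<forall>j. c (\<beta>, j) < \<alpha>)}"
  \<comment> \<open>Off \<open>C\<close> some codes may lie beyond \<alpha>. The constant 0 keeps
    \<open>F\<close> Borel there, and only stages in \<open>C\<close> are selected later.\<close>
  define F where "F \<alpha> = (if \<alpha> \<in> C then \<lambda>s. G (\<lambda>(i, j). s (c (from_nat_into {..<\<alpha>} i, j))) else (\<lambda>_ _. 0))" for \<alpha>
  have e: "from_nat_into {..<\<alpha>} i < \<alpha>" if "\<alpha> \<in> C" for \<alpha> i
  proof -
    have "{..<\<alpha>} \<noteq> {}"
      using that infinite_imp_nonempty by (auto simp: C_def)
    then show ?thesis
      using from_nat_into[of "{..<\<alpha>}" i] by simp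
  qed
  have "Borel_fun F"
    unfolding Borel_fun_def
  proof
    fix \<alpha>
    show "F \<alpha> \<in> borel_of (Cantor_pow \<alpha>) \<rightarrow>\<^sub>M borel"
    proof (cases "\<alpha> \<in> C")
      case True
      have 1: "(\<lambda>s ij. s (c (from_nat_into {..<\<alpha>} (fst ij), snd ij)))
          \<in> borel_of (Cantor_pow \<alpha>) \<rightarrow>\<^sub>M PiM (UNIV :: (nat \<times> 'c) set) (\<lambda>_. count_space UNIV)"
      proof (rule measurable_PiM_single')
        fix ij :: "nat \<times> 'c"
        have "c (from_nat_into {..<\<alpha>} (fst ij), snd ij) < \<alpha>"
          using True e[OF True] by (simp add: C_def)
        then show "(\<lambda>s. s (c (from_nat_into {..<\<alpha>} (fst ij), snd ij))) \<in> borel_of (Cantor_pow \<alpha>) \<rightarrow>\<^sub>M count_space UNIV"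
          by (rule measurable_Cantor_pow_component)
      qed auto
      have "(\<lambda>s. F \<alpha> s k) \<in> borel_of (Cantor_pow \<alpha>) \<rightarrow>\<^sub>M borel" for k
        using measurable_compose[OF 1 meas[of k]] True
        by (simp add: F_def case_prod_unfold measurable_cong_sets[OF refl sets_borel_eq_count_space])
      then show ?thesis
        by (rule measurable_coordinatewise_then_product)
    qed (simp add: F_def)
  qed
  then obtain g where g: "\<And>f. stationary {\<alpha>. \<not> F \<alpha> (restrict f {..<\<alpha>}) \<ge>\<^sup>* g \<alpha>}"
    using assms(1) unfolding diamond_b_def by blast
  show ?thesis
  proof (intro exI[of _ g] allI)
    fix x :: "omega1 \<Rightarrow> 'c \<Rightarrow> bool"
    define f where "f \<xi> = case_prod x (inv c \<xi>)" for \<xi>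
    have f: "f (c (\<beta>, j)) = x \<beta> j" for \<beta> j
      by (simp add: f_def c)
    have "club C"
      unfolding C_def by (rule club_closed_under)
    then obtain \<alpha> where \<alpha>: "\<alpha> \<in> C" "\<not> F \<alpha> (restrict f {..<\<alpha>}) \<ge>\<^sup>* g \<alpha>"
      using g[of f] unfolding stationary_def by blast
    have "c (from_nat_into {..<\<alpha>} i, j) < \<alpha>" for i j
      using \<alpha>(1) e[OF \<alpha>(1)] by (simp add: C_def)
    then have "restrict f {..<\<alpha>} (c (from_nat_into {..<\<alpha>} i, j)) = x (from_nat_into {..<\<alpha>} i) j" for i j
      by (simp add: f)
    then have "infinite {k. G (\<lambda>(i, j). x (from_nat_into {..<\<alpha>} i) j) k < g \<alpha> k}"
      using \<alpha> by (simp add: F_def ge_star_def not_le)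
    then show "\<exists>\<alpha>. infinite {..<\<alpha>} \<and> infinite {k. G (\<lambda>(i, j). x (from_nat_into {..<\<alpha>} i) j) k < g \<alpha> k}"
      using \<alpha>(1) by (auto simp: C_def)
  qed
qed

section \<open>The almost disjoint family\<close>

text \<open>Indices of the bits recorded for a stage \<beta>: the points of
  \<open>a \<beta>\<close>, whether \<beta> is in \<open>S\<close>, the graph of \<open>D\<close>,
  and the points of \<open>W\<close>.\<close>

datatype code = InA nat | InS | InD nat nat | InW nat

instance code :: countable
  by countable_datatype

text \<open>Here \<open>y (i, _)\<close> is the code attached to the \<open>i\<close>-th predecessor of the current stage.  The data
  \<open>D\<close> and \<open>W\<close>, which do not depend on the stage, are repeated in every code and read off at \<open>i = 0\<close>.\<close>

definition guess_bound :: "(nat \<times> code \<Rightarrow> bool) \<Rightarrow> nat \<Rightarrow> nat" where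
  "guess_bound y k = (LEAST m. \<exists>n.
     (\<forall>i. i \<le> k \<longrightarrow> y (i, InS) \<longrightarrow> (\<exists>x. k \<le> x \<and> y (0, InD n x) \<and> y (i, InA x))) \<and>
     (\<exists>x. k \<le> x \<and> x < m \<and> y (0, InD n x) \<and> \<not> y (0, InW x) \<and> (\<forall>i. i \<le> k \<longrightarrow> \<not> y (i, InA x))))"

text \<open>The bound arises from coordinates \<open>y (i, j)\<close> by countable quantification
  and a least natural number, which makes it admissible for the diamond principle.\<close>

lemma measurable_guess_bound:
  "(\<lambda>y. guess_bound y k) \<in> PiM UNIV (\<lambda>_. count_space UNIV) \<rightarrow>\<^sub>M count_space UNIV"
proof -
  have [measurable]: "Measurable.pred (PiM UNIV (\<lambda>_. count_space UNIV)) (\<lambda>y. y (i, j))" for i :: nat and j :: code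
    by (rule measurable_component_singleton) simp
  show ?thesis
    unfolding guess_bound_def by measurable
qed

section \<open>Infinite sets almost disjoint from a given sequence\<close>

text \<open>Added to \<open>h k\<close> in \<open>fill\<close>, this keeps the set infinite even
  where \<open>h\<close> is small. \<open>Suc\<close> turns the least admissible point into a strict
  upper bound.\<close>

definition avoid_bound :: "(nat \<Rightarrow> nat set) \<Rightarrow> nat \<Rightarrow> nat" where
  "avoid_bound b k = Suc (LEAST x. k \<le> x \<and> (\<forall>i\<le>k. x \<notin> b i))"

definition fill :: "(nat \<Rightarrow> nat) \<Rightarrow> (nat \<Rightarrow> nat set) \<Rightarrow> nat set" where
  "fill h b = {x. \<exists>k. x < h k + avoid_bound b k \<and> (\<forall>i\<le>k. x \<notin> b i)}"

text \<open>A point of \<open>b i\<close> can enter only through a piece with \<open>k < i\<close>,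
  and each of these finitely many pieces is bounded.\<close>

lemma finite_fill_Int: "finite (fill h b \<inter> b i)"
proof (rule finite_subset)
  show "fill h b \<inter> b i \<subseteq> (\<Union>k<i. {..<h k + avoid_bound b k})"
  proof
    fix x assume "x \<in> fill h b \<inter> b i"
    then obtain k where k: "x < h k + avoid_bound b k" "\<forall>i\<le>k. x \<notin> b i" "x \<in> b i"
      by (auto simp: fill_def)
    then have "k < i"
      using not_less by blast
    with k(1) show "x \<in> (\<Union>k<i. {..<h k + avoid_bound b k})"
      by blast
  qed
qed simp

text \<open>The \<open>k\<close>-th piece contains the point that defines
  \<open>avoid_bound b k\<close>, and this point is at least \<open>k\<close>.\<close>

lemma infinite_fill:
  assumes "\<And>k. infinite (- (\<Union>i\<le>k. b i))"
  shows "infinite (fill h b)"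
  unfolding infinite_nat_iff_unbounded_le
proof
  fix k
  define x where "x = (LEAST x. k \<le> x \<and> (\<forall>i\<le>k. x \<notin> b i))"
  obtain z where "k \<le> z" "z \<in> - (\<Union>i\<le>k. b i)"
    using assms[of k] unfolding infinite_nat_iff_unbounded_le by blast
  then have "k \<le> z \<and> (\<forall>i\<le>k. z \<notin> b i)"
    by auto
  then have x: "k \<le> x \<and> (\<forall>i\<le>k. x \<notin> b i)"
    unfolding x_def by (rule LeastI)
  then have "x \<in> fill h b"
    by (auto simp: fill_def avoid_bound_def x_def[symmetric] intro!: exI[of _ k])
  with x show "\<exists>n\<ge>k. n \<in> fill h b"
    by blast
qed

text \<open>The finite stages are the members of a fixed partition of \<open>\<nat>\<close> into infinitely many infinite
  sets, so that no later stage has to extend a finite family.\<close>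

function ladder_family :: "(omega1 \<Rightarrow> nat \<Rightarrow> nat) \<Rightarrow> omega1 \<Rightarrow> nat set" where
  "ladder_family g \<alpha> =
     (if finite {..<\<alpha>} then {x. fst (prod_decode x) = card {..<\<alpha>}}
      else fill (g \<alpha>) (\<lambda>i. ladder_family g (from_nat_into {..<\<alpha>} i)))"
  by auto

termination
proof (relation "inv_image {(\<beta>, \<alpha>). \<beta> < \<alpha>} snd")
  show "wf (inv_image {(\<beta>, \<alpha> :: omega1). \<beta> < \<alpha>} snd)"
    by (rule wf_inv_image[OF wf])
  fix \<alpha> :: omega1 and g :: "omega1 \<Rightarrow> nat \<Rightarrow> nat" and i
  assume "infinite {..<\<alpha>}"
  then have "{..<\<alpha>} \<noteq> {}"
    by (rule infinite_imp_nonempty)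
  from from_nat_into[OF this, of i]
  show "((g, from_nat_into {..<\<alpha>} i), g, \<alpha>) \<in> inv_image {(\<beta>, \<alpha>). \<beta> < \<alpha>} snd"
    by simp
qed

declare ladder_family.simps[simp del]

text \<open>Finite stages are distinct columns of the pairing function. At infinite stages
  \<open>fill\<close> applies, once the induction hypothesis shows that finitely many earlier sets
  never almost cover the natural numbers.\<close>

lemma ladder_family_almost_disjoint:
  "infinite (ladder_family g \<alpha>) \<and> (\<forall>\<beta><\<alpha>. finite (ladder_family g \<alpha> \<inter> ladder_family g \<beta>))"
proof (induction \<alpha> rule: less_induct)
  case (less \<alpha>)
  let ?a = "ladder_family g"
  show ?case
  proof (cases "finite {..<\<alpha>}")
    case True
    have eq: "?a \<beta> = {x. fst (prod_decode x) = card {..<\<beta>}}" if "\<beta> \<le> \<alpha>" for \<beta>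
    proof -
      have "{..<\<beta>} \<subseteq> {..<\<alpha>}"
        using that by auto
      then have "finite {..<\<beta>}"
        using True by (rule finite_subset)
      then show ?thesis
        by (simp add: ladder_family.simps[of g \<beta>])
    qed
    have "range (\<lambda>j. prod_encode (card {..<\<alpha>}, j)) \<subseteq> ?a \<alpha>"
      by (auto simp: eq)
    moreover have "inj (\<lambda>j. prod_encode (card {..<\<alpha>}, j))"
      by (auto intro: injI)
    ultimately have "infinite (?a \<alpha>)"
      using range_inj_infinite infinite_super by blast
    moreover have "finite (?a \<alpha> \<inter> ?a \<beta>)" if "\<beta> < \<alpha>" for \<beta>
    proof -
      have "{..<\<beta>} \<subset> {..<\<alpha>}"
        using that by auto
      then have "card {..<\<beta>} < card {..<\<alpha>}"
        using True by (rule psubset_card_mono[rotated])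
      then have "?a \<alpha> \<inter> ?a \<beta> = {}"
        using that by (auto simp: eq)
      then show ?thesis
        by simp
    qed
    ultimately show ?thesis
      by blast
  next
    case False
    let ?e = "from_nat_into {..<\<alpha>}"
    have a: "?a \<alpha> = fill (g \<alpha>) (\<lambda>i. ?a (?e i))"
      using False by (simp add: ladder_family.simps[of g \<alpha>])
    have fin: "finite (?a \<beta> \<inter> ?a \<gamma>)" if "\<beta> < \<alpha>" "\<gamma> < \<alpha>" "\<beta> \<noteq> \<gamma>" for \<beta> \<gamma>
      using less[of \<beta>] less[of \<gamma>] that by (metis Int_commute neqE)
    have e: "range ?e = {..<\<alpha>}"
      using False by (intro range_from_nat_into countable_lessThan_omega1 infinite_imp_nonempty)
    have "infinite (- (\<Union>i\<le>k. ?a (?e i)))" for k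
    proof -
      \<comment> \<open>Infinitely many predecessors leave some \<beta> outside the first
        \<open>k + 1\<close>; \<open>a \<beta>\<close> loses only finitely many points to their
        sets.\<close>
      have "\<not> {..<\<alpha>} \<subseteq> ?e ` {..k}"
        using False finite_subset by blast
      then obtain \<beta> where \<beta>: "\<beta> < \<alpha>" "\<beta> \<notin> ?e ` {..k}"
        by auto
      have "?e i < \<alpha>" for i
        using e by blast
      then have "finite (?a \<beta> \<inter> ?a (?e i))" if "i \<le> k" for i
        using that \<beta> by (intro fin) auto
      then have "finite (\<Union>i\<le>k. ?a \<beta> \<inter> ?a (?e i))"
        by (intro finite_UN_I) simp_all
      then have "infinite (?a \<beta> - (\<Union>i\<le>k. ?a \<beta> \<inter> ?a (?e i)))"
        using less[OF \<beta>(1)] by (intro Diff_infinite_finite) auto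
      then show ?thesis
        by (rule infinite_super[rotated]) auto
    qed
    then have "infinite (?a \<alpha>)"
      unfolding a by (rule infinite_fill)
    moreover have "finite (?a \<alpha> \<inter> ?a \<beta>)" if "\<beta> < \<alpha>" for \<beta>
    proof -
      obtain i where "\<beta> = ?e i"
        using e \<open>\<beta> < \<alpha>\<close> by (metis imageE lessThan_iff)
      then show ?thesis
        unfolding a using finite_fill_Int[of "g \<alpha>" "\<lambda>i. ?a (?e i)" i] by simp
    qed
    ultimately show ?thesis
      by blast
  qed
qed

text \<open>The premise of \<open>guess\<close> says that \<open>guess_bound\<close> is the least element of a nonempty set, and the
  conclusion is what a stage that exceeds it infinitely often achieves.\<close>

locale guessing_family =
  fixes a :: "omega1 \<Rightarrow> nat set"
  assumes infinite_a: "infinite (a \<alpha>)"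
    and almost_disjoint_a: "\<alpha> \<noteq> \<beta> \<Longrightarrow> finite (a \<alpha> \<inter> a \<beta>)"
    and guess: "\<And>D :: nat \<Rightarrow> nat set. \<exists>\<alpha>.
      (\<forall>T m. finite T \<longrightarrow> T \<subseteq> {..<\<alpha>} \<longrightarrow>
        (\<exists>n. (\<forall>\<beta>\<in>T \<inter> S. D n \<inter> a \<beta> \<inter> {m..} \<noteq> {}) \<and> D n \<inter> {m..} - W - (\<Union>\<beta>\<in>T. a \<beta>) \<noteq> {}))
      \<longrightarrow>
      (\<forall>T m. finite T \<longrightarrow> T \<subseteq> {..<\<alpha>} \<longrightarrow>
        (\<exists>n. (\<forall>\<beta>\<in>T \<inter> S. D n \<inter> a \<beta> \<inter> {m..} \<noteq> {}) \<and> D n \<inter> a \<alpha> \<inter> {m..} - W \<noteq> {}))"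

text \<open>Whenever \<open>g \<alpha> k\<close> exceeds the guessed bound, the point realizing that
  bound falls into the \<open>k\<close>-th piece of \<open>a \<alpha>\<close>.\<close>

lemma diamond_b_guessing_family:
  assumes "diamond_b"
  obtains a where "guessing_family a"
proof -
  obtain g where g: "\<forall>x :: omega1 \<Rightarrow> code \<Rightarrow> bool. \<exists>\<alpha>. infinite {..<\<alpha>} \<and>
      infinite {k. guess_bound (\<lambda>(i, j). x (from_nat_into {..<\<alpha>} i) j) k < g \<alpha> k}"
    using diamond_b_guess[OF assms measurable_guess_bound] ..
  define a where "a = ladder_family g"
  have "guessing_family a"
  proof
    show "infinite (a \<alpha>)" for \<alpha>
      using ladder_family_almost_disjoint by (simp add: a_def)
    show "finite (a \<alpha> \<inter> a \<beta>)" if "\<alpha> \<noteq> \<beta>" for \<alpha> \<beta>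
      using ladder_family_almost_disjoint[of g \<alpha>] ladder_family_almost_disjoint[of g \<beta>] that
      by (metis Int_commute a_def neqE)
    fix S and D :: "nat \<Rightarrow> nat set" and W
    define x where "x \<beta> j = (case j of InA n \<Rightarrow> n \<in> a \<beta> | InS \<Rightarrow> \<beta> \<in> S | InD n z \<Rightarrow> z \<in> D n | InW z \<Rightarrow> z \<in> W)" for \<beta> j
    obtain \<alpha> where inf: "infinite {..<\<alpha>}"
      and hit: "infinite {k. guess_bound (\<lambda>(i, j). x (from_nat_into {..<\<alpha>} i) j) k < g \<alpha> k}"
      using g by blast
    let ?e = "from_nat_into {..<\<alpha>}"
    let ?G = "\<lambda>k. guess_bound (\<lambda>(i, j). x (?e i) j) k"
    have e: "range ?e = {..<\<alpha>}"
      using inf by (intro range_from_nat_into countable_lessThan_omega1 infinite_imp_nonempty)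
    have a: "a \<alpha> = fill (g \<alpha>) (\<lambda>i. a (?e i))"
      using inf by (simp add: a_def ladder_family.simps[of g \<alpha>])
    have *: "\<exists>n. (\<forall>\<beta>\<in>T \<inter> S. D n \<inter> a \<beta> \<inter> {m..} \<noteq> {}) \<and> D n \<inter> a \<alpha> \<inter> {m..} - W \<noteq> {}"
      if T: "finite T" "T \<subseteq> {..<\<alpha>}" and hyp: "\<And>T m. finite T \<Longrightarrow> T \<subseteq> {..<\<alpha>} \<Longrightarrow>
        \<exists>n. (\<forall>\<beta>\<in>T \<inter> S. D n \<inter> a \<beta> \<inter> {m..} \<noteq> {}) \<and> D n \<inter> {m..} - W - (\<Union>\<beta>\<in>T. a \<beta>) \<noteq> {}"
      for T m
    proof -
      obtain I where I: "finite I" "T = ?e ` I"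
        using finite_subset_image[of T ?e UNIV] T e by auto
      obtain k0 where k0: "I \<subseteq> {..k0}"
        using I(1) finite_nat_iff_bounded_le by blast
      \<comment> \<open>A successful guess beyond both \<open>m\<close> and all enumeration indices
        of \<open>T\<close>.\<close>
      obtain k where k: "max m k0 \<le> k" "?G k < g \<alpha> k"
        using hit unfolding infinite_nat_iff_unbounded_le by blast
      have Tk: "T \<subseteq> ?e ` {..k}"
        using I(2) k0 k(1) by auto
      define P where "P m' n \<longleftrightarrow> (\<forall>i. i \<le> k \<longrightarrow> ?e i \<in> S \<longrightarrow> (\<exists>z. k \<le> z \<and> z \<in> D n \<and> z \<in> a (?e i))) \<and>
        (\<exists>z. k \<le> z \<and> z < m' \<and> z \<in> D n \<and> z \<notin> W \<and> (\<forall>i. i \<le> k \<longrightarrow> z \<notin> a (?e i)))" for m' n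
      have G: "?G k = (LEAST m'. \<exists>n. P m' n)"
        by (simp add: guess_bound_def P_def x_def)
      \<comment> \<open>The premise for the first \<open>k + 1\<close> predecessors yields a
        candidate for the \<open>LEAST\<close>, so the minimum is attained.\<close>
      have "finite (?e ` {..k})" "?e ` {..k} \<subseteq> {..<\<alpha>}"
        using e by auto
      from hyp[OF this, of k] obtain n z
        where "\<forall>\<beta>\<in>?e ` {..k} \<inter> S. D n \<inter> a \<beta> \<inter> {k..} \<noteq> {}"
          and "z \<in> D n \<inter> {k..} - W - (\<Union>\<beta>\<in>?e ` {..k}. a \<beta>)"
        by blast
      then have "P (Suc z) n"
        unfolding P_def by fastforce
      then have "\<exists>n. P (?G k) n"
        unfolding G by (rule_tac LeastI) blast
      then obtain n where n: "P (?G k) n" ..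
      then obtain z where z: "k \<le> z" "z < ?G k" "z \<in> D n" "z \<notin> W" "\<forall>i\<le>k. z \<notin> a (?e i)"
        unfolding P_def by blast
      have "z \<in> a \<alpha>"
        unfolding a fill_def using z k(2) by (auto intro!: exI[of _ k])
      then have "z \<in> D n \<inter> a \<alpha> \<inter> {m..} - W"
        using z k(1) by auto
      moreover have "D n \<inter> a \<beta> \<inter> {m..} \<noteq> {}" if "\<beta> \<in> T \<inter> S" for \<beta>
      proof -
        from that Tk obtain i where "i \<le> k" "\<beta> = ?e i"
          by auto
        with that n obtain y where "k \<le> y" "y \<in> D n" "y \<in> a \<beta>"
          unfolding P_def by blast
        then show ?thesis
          using k(1) by auto
      qed
      ultimately show ?thesis
        by blast
    qed
    show "\<exists>\<alpha>. (\<forall>T m. finite T \<longrightarrow> T \<subseteq> {..<\<alpha>} \<longrightarrow>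
        (\<exists>n. (\<forall>\<beta>\<in>T \<inter> S. D n \<inter> a \<beta> \<inter> {m..} \<noteq> {}) \<and> D n \<inter> {m..} - W - (\<Union>\<beta>\<in>T. a \<beta>) \<noteq> {}))
      \<longrightarrow>
      (\<forall>T m. finite T \<longrightarrow> T \<subseteq> {..<\<alpha>} \<longrightarrow>
        (\<exists>n. (\<forall>\<beta>\<in>T \<inter> S. D n \<inter> a \<beta> \<inter> {m..} \<noteq> {}) \<and> D n \<inter> a \<alpha> \<inter> {m..} - W \<noteq> {}))"
      by (intro exI[of _ \<alpha>] impI allI *) auto
  qed
  then show ?thesis
    by (rule that)
qed

section \<open>Hyperspaces of $\Psi$-spaces\<close>

text \<open>The points \<open>Inl n\<close> are isolated, so only points \<open>Inr b\<close> impose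
  a condition.\<close>

lemma openin_Psi_cases:
  assumes "\<And>b. Inr b \<in> U \<Longrightarrow> b \<in> A \<and> (\<exists>F. finite F \<and> Inl ` (b - F) \<subseteq> U)"
  shows "openin (Psi A) U"
  unfolding openin_Psi_iff
proof
  fix x assume x: "x \<in> U"
  show "\<exists>B\<in>Psi_base A. x \<in> B \<and> B \<subseteq> U"
  proof (cases x)
    case (Inl n)
    then show ?thesis
      using x by (intro bexI[of _ "{Inl n}"]) (auto simp: Psi_base_def)
  next
    case (Inr b)
    then obtain F where "b \<in> A" "finite F" "Inl ` (b - F) \<subseteq> U"
      using assms x by blast
    then show ?thesis
      using x Inr by (intro bexI[of _ "insert (Inr b) (Inl ` (b - F))"]) (auto simp: Psi_base_def)
  qed
qed

lemma openin_Psi_Inr: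
  assumes "openin (Psi A) U" "Inr b \<in> U"
  obtains F where "b \<in> A" "finite F" "Inl ` (b - F) \<subseteq> U"
proof -
  obtain B where "B \<in> Psi_base A" "Inr b \<in> B" "B \<subseteq> U"
    using assms unfolding openin_Psi_iff by blast
  then show ?thesis
    using that by (auto simp: Psi_base_def)
qed

lemma closedin_Psi_finite:
  assumes "finite D"
  shows "closedin (Psi A) (Inl ` D)"
  unfolding closedin_def
proof
  show "Inl ` D \<subseteq> topspace (Psi A)"
    by (auto simp: topspace_Psi)
  show "openin (Psi A) (topspace (Psi A) - Inl ` D)"
    by (rule openin_Psi_cases) (use assms in \<open>auto simp: topspace_Psi\<close>)
qed

lemma dense_Inl_Psi:
  assumes "\<forall>b\<in>A. infinite b" "openin (Psi A) U" "U \<noteq> {}"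
  obtains n where "Inl n \<in> U"
proof -
  obtain x where x: "x \<in> U"
    using assms(3) by blast
  show ?thesis
  proof (cases x)
    case (Inr b)
    then obtain F where F: "b \<in> A" "finite F" "Inl ` (b - F) \<subseteq> U"
      using openin_Psi_Inr assms(2) x by blast
    then have "b - F \<noteq> {}"
      using assms(1) by (metis Diff_infinite_finite finite.emptyI)
    then show ?thesis
      using F(3) that by blast
  qed (use x that in blast)
qed

section \<open>Neighbourhoods and a dense set in the hyperspace\<close>

text \<open>Upper sets are closed under finite intersection, so a basic neighbourhood needs one
  upper set \<open>U\<close> and finitely many lower sets.\<close>

lemma openin_Vietoris_nbhd:
  assumes "openin (Vietoris X) \<U>" "K \<in> \<U>"
  shows "\<exists>U \<V>. openin X U \<and> K \<subseteq> U \<and> finite \<V> \<and> (\<forall>V\<in>\<V>. openin X V \<and> K \<inter> V \<noteq> {}) \<and>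
    (\<forall>L. closedin X L \<longrightarrow> L \<noteq> {} \<longrightarrow> L \<subseteq> U \<longrightarrow> (\<forall>V\<in>\<V>. L \<inter> V \<noteq> {}) \<longrightarrow> L \<in> \<U>)"
    (is "?nbhd \<U>")
proof -
  have "generate_topology_on ({exp_upper X U | U. openin X U} \<union> {exp_lower X U | U. openin X U}) \<U>"
    using assms(1) by (simp add: Vietoris_def openin_topology_generated_by_iff)
  then show ?thesis
    using assms(2)
  proof induction
    case (Int \<A> \<B>)
    then obtain U \<V> where 1: "openin X U" "K \<subseteq> U" "finite \<V>" "\<forall>V\<in>\<V>. openin X V \<and> K \<inter> V \<noteq> {}"
      "\<forall>L. closedin X L \<longrightarrow> L \<noteq> {} \<longrightarrow> L \<subseteq> U \<longrightarrow> (\<forall>V\<in>\<V>. L \<inter> V \<noteq> {}) \<longrightarrow> L \<in> \<A>"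
      by auto
    from Int obtain U' \<V>' where 2: "openin X U'" "K \<subseteq> U'" "finite \<V>'" "\<forall>V\<in>\<V>'. openin X V \<and> K \<inter> V \<noteq> {}"
      "\<forall>L. closedin X L \<longrightarrow> L \<noteq> {} \<longrightarrow> L \<subseteq> U' \<longrightarrow> (\<forall>V\<in>\<V>'. L \<inter> V \<noteq> {}) \<longrightarrow> L \<in> \<B>"
      by auto
    show ?case
      by (rule exI[of _ "U \<inter> U'"], rule exI[of _ "\<V> \<union> \<V>'"]) (use 1 2 in auto)
  next
    case (UN \<K>)
    then obtain \<A> where "\<A> \<in> \<K>" "K \<in> \<A>"
      by blast
    from UN.IH[OF this] obtain U \<V> where "openin X U" "K \<subseteq> U" "finite \<V>" "\<forall>V\<in>\<V>. openin X V \<and> K \<inter> V \<noteq> {}"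
      "\<forall>L. closedin X L \<longrightarrow> L \<noteq> {} \<longrightarrow> L \<subseteq> U \<longrightarrow> (\<forall>V\<in>\<V>. L \<inter> V \<noteq> {}) \<longrightarrow> L \<in> \<A>"
      by (elim exE conjE)
    with \<open>\<A> \<in> \<K>\<close> show ?case
      by (intro exI[of _ U] exI[of _ \<V>]) auto
  next
    case (Basis \<S>)
    then consider U where "openin X U" "\<S> = exp_upper X U" | U where "openin X U" "\<S> = exp_lower X U"
      by blast
    then show ?case
    proof cases
      case 1
      then show ?thesis
        using Basis by (intro exI[of _ U] exI[of _ "{}"]) (auto simp: exp_upper_def)
    next
      case 2
      have "K \<subseteq> topspace X"
        using 2 Basis closedin_subset by (auto simp: exp_lower_def)
      then show ?thesis
        using 2 Basis
        by (intro exI[of _ "topspace X"] exI[of _ "{U}"]) (auto simp: exp_lower_def)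
    qed
  qed simp
qed

text \<open>Inside a basic neighbourhood, density of the isolated points allows picking one natural
  number from \<open>U \<inter> V\<close> for each of the finitely many \<open>V\<close>.\<close>

lemma dense_finite_Vietoris_Psi:
  assumes "\<forall>b\<in>A. infinite b" "openin (Vietoris (Psi A)) \<U>" "\<U> \<noteq> {}"
  obtains D where "finite D" "D \<noteq> {}" "Inl ` D \<in> \<U>"
proof -
  obtain K where K: "K \<in> \<U>"
    using assms(3) by blast
  then have "K \<noteq> {}"
    using openin_subset[OF assms(2)] by (auto simp: topspace_Vietoris)
  from openin_Vietoris_nbhd[OF assms(2) K] obtain U \<V> where U: "openin (Psi A) U" "K \<subseteq> U"
    and \<V>: "finite \<V>" "\<forall>V\<in>\<V>. openin (Psi A) V \<and> K \<inter> V \<noteq> {}"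
    and nbhd: "\<forall>L. closedin (Psi A) L \<longrightarrow> L \<noteq> {} \<longrightarrow> L \<subseteq> U \<longrightarrow> (\<forall>V\<in>\<V>. L \<inter> V \<noteq> {}) \<longrightarrow> L \<in> \<U>"
    by auto
  have "\<exists>n. Inl n \<in> U \<inter> V" if "openin (Psi A) V" "K \<inter> V \<noteq> {}" for V
  proof -
    have "openin (Psi A) (U \<inter> V)" "U \<inter> V \<noteq> {}"
      using U that by auto
    then show ?thesis
      using dense_Inl_Psi[OF assms(1)] by metis
  qed
  then obtain d where d: "\<And>V. openin (Psi A) V \<Longrightarrow> K \<inter> V \<noteq> {} \<Longrightarrow> Inl (d V) \<in> U \<inter> V"
    by metis
  \<comment> \<open>\<open>U\<close> itself is among the sets to be hit, so the chosen finite set is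
    nonempty even if \<open>\<V>\<close> is empty.\<close>
  have "K \<inter> U \<noteq> {}"
    using \<open>K \<noteq> {}\<close> U by blast
  then have "Inl ` d ` insert U \<V> \<subseteq> U"
    using d[OF U(1)] d \<V> by auto
  moreover have "\<forall>V\<in>\<V>. Inl ` d ` insert U \<V> \<inter> V \<noteq> {}"
  proof
    fix V assume "V \<in> \<V>"
    then have "Inl (d V) \<in> Inl ` d ` insert U \<V> \<inter> V"
      using d[of V] \<V>(2) by simp
    then show "Inl ` d ` insert U \<V> \<inter> V \<noteq> {}"
      by (metis empty_iff)
  qed
  ultimately have "Inl ` d ` insert U \<V> \<in> \<U>"
    using nbhd closedin_Psi_finite[of "d ` insert U \<V>" A] \<V>(1) by auto
  with \<V>(1) show ?thesis
    by (intro that[of "d ` insert U \<V>"]) auto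
qed

text \<open>An unbounded \<open>f\<close> would be unbounded along some sequence of finite sets, by
  density. At a limit \<open>K\<close>, continuity bounds \<open>f\<close> by
  \<open>\<bar>f K\<bar> + 1\<close> for \<open>p\<close>-many terms, while \<open>p\<close> refines
  the cofinite filter.\<close>

lemma pseudocompact_Vietoris_Psi:
  assumes "\<forall>b\<in>A. infinite b"
    and limit: "\<And>D :: nat \<Rightarrow> nat set. (\<And>n. finite (D n)) \<Longrightarrow> (\<And>n. D n \<noteq> {}) \<Longrightarrow>
      \<exists>p K. p \<noteq> bot \<and> p \<le> sequentially \<and> closedin (Psi A) K \<and>
        (\<forall>U. openin (Psi A) U \<longrightarrow> K \<subseteq> U \<longrightarrow> (\<forall>\<^sub>F n in p. Inl ` D n \<subseteq> U)) \<and>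
        (\<forall>U. openin (Psi A) U \<longrightarrow> K \<inter> U \<noteq> {} \<longrightarrow> (\<forall>\<^sub>F n in p. Inl ` D n \<inter> U \<noteq> {}))"
  shows "pseudocompact_space (Vietoris (Psi A))"
  unfolding pseudocompact_space_def
proof (intro allI impI)
  let ?X = "Vietoris (Psi A)"
  fix f assume f: "continuous_map ?X euclideanreal f"
  show "bounded (f ` topspace ?X)"
  proof (rule ccontr)
    assume unb: "\<not> bounded (f ` topspace ?X)"
    have "\<exists>D. finite D \<and> D \<noteq> {} \<and> real n < \<bar>f (Inl ` D)\<bar>" for n
    proof -
      let ?U = "{K \<in> topspace ?X. f K \<in> {y. real n < \<bar>y\<bar>}}"
      have "open {y. real n < \<bar>y :: real\<bar>}"
        by (intro open_Collect_less continuous_intros)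
      then have "openin ?X ?U"
        using f openin_continuous_map_preimage by fastforce
      moreover have "?U \<noteq> {}"
        using unb by (auto simp: bounded_iff not_le)
      ultimately obtain D where "finite D" "D \<noteq> {}" "Inl ` D \<in> ?U"
        by (rule dense_finite_Vietoris_Psi[OF assms(1)])
      then show ?thesis
        by blast
    qed
    then obtain D where D: "\<And>n. finite (D n)" "\<And>n. D n \<noteq> {}" "\<And>n. real n < \<bar>f (Inl ` D n)\<bar>"
      by metis
    from limit[of D, OF D(1,2)] obtain p K where p: "p \<noteq> bot" "p \<le> sequentially" and "closedin (Psi A) K"
      and upper: "\<forall>U. openin (Psi A) U \<longrightarrow> K \<subseteq> U \<longrightarrow> (\<forall>\<^sub>F n in p. Inl ` D n \<subseteq> U)"
      and lower: "\<forall>U. openin (Psi A) U \<longrightarrow> K \<inter> U \<noteq> {} \<longrightarrow> (\<forall>\<^sub>F n in p. Inl ` D n \<inter> U \<noteq> {})"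
      by (elim exE conjE)
    have "K \<noteq> {}"
    proof
      assume "K = {}"
      then have "\<forall>\<^sub>F n in p. False"
        using upper[rule_format, of "{}"] D(2) by simp
      with p(1) show False
        by simp
    qed
    then have K: "K \<in> topspace ?X"
      using \<open>closedin (Psi A) K\<close> by (simp add: topspace_Vietoris)
    let ?U = "{L \<in> topspace ?X. f L \<in> {y. \<bar>y\<bar> < \<bar>f K\<bar> + 1}}"
    have "open {y. \<bar>y :: real\<bar> < \<bar>f K\<bar> + 1}"
      by (intro open_Collect_less continuous_intros)
    then have "openin ?X ?U"
      using f openin_continuous_map_preimage by fastforce
    moreover have "K \<in> ?U"
      using K by simp
    ultimately obtain U \<V> where "openin (Psi A) U" "K \<subseteq> U"
      and \<V>: "finite \<V>" "\<And>V. V \<in> \<V> \<Longrightarrow> openin (Psi A) V \<and> K \<inter> V \<noteq> {}"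
      and nbhd: "\<And>L. closedin (Psi A) L \<Longrightarrow> L \<noteq> {} \<Longrightarrow> L \<subseteq> U \<Longrightarrow> (\<forall>V\<in>\<V>. L \<inter> V \<noteq> {}) \<Longrightarrow> L \<in> ?U"
      using openin_Vietoris_nbhd[of "Psi A" ?U K] by auto
    have "\<forall>\<^sub>F n in p. Inl ` D n \<subseteq> U"
      by (rule upper[rule_format]) fact+
    moreover have "\<forall>\<^sub>F n in p. \<forall>V\<in>\<V>. Inl ` D n \<inter> V \<noteq> {}"
      using \<V> lower by (intro eventually_ball_finite) blast+
    moreover have "\<forall>\<^sub>F n in p. nat \<lceil>\<bar>f K\<bar> + 1\<rceil> \<le> n"
      using p(2) eventually_ge_at_top filter_leD by blast
    ultimately have "\<forall>\<^sub>F n in p. False"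
    proof eventually_elim
      case (elim n)
      have "Inl ` D n \<in> ?U"
        using elim(1,2) D closedin_Psi_finite by (intro nbhd) auto
      moreover have "\<bar>f K\<bar> + 1 \<le> real n"
        using elim(3) by linarith
      ultimately show False
        using D(3)[of n] by simp
    qed
    with p(1) show False
      by simp
  qed
qed

section \<open>Limits of sequences of finite sets\<close>

context guessing_family
begin

lemma inj_a: "inj a"
proof (rule injI, rule ccontr)
  fix \<alpha> \<beta> assume "a \<alpha> = a \<beta>" "\<alpha> \<noteq> \<beta>"
  then show False
    using almost_disjoint_a[of \<alpha> \<beta>] infinite_a[of \<beta>] by simp
qed

section \<open>The filter of traces of a sequence of sets\<close>

text \<open>Properness of this filter is the finite intersection property used in the greedy choice.
  One \<open>m\<close> bounds both the indices and the points, so unions and maxima make the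
  generators a filter base.\<close>

definition trace_filter :: "(nat \<Rightarrow> nat set) \<Rightarrow> omega1 set \<Rightarrow> nat filter" where
  "trace_filter D T = (INF (T', m) \<in> {T'. finite T' \<and> T' \<subseteq> T} \<times> UNIV.
     principal {n. m \<le> n \<and> (\<forall>\<beta>\<in>T'. D n \<inter> a \<beta> \<inter> {m..} \<noteq> {})})"

lemma eventually_trace_filter:
  "eventually P (trace_filter D T) \<longleftrightarrow> (\<exists>T' m. finite T' \<and> T' \<subseteq> T \<and>
     (\<forall>n\<ge>m. (\<forall>\<beta>\<in>T'. D n \<inter> a \<beta> \<inter> {m..} \<noteq> {}) \<longrightarrow> P n))"
proof -
  let ?I = "{T'. finite T' \<and> T' \<subseteq> T} \<times> (UNIV :: nat set)"
  let ?B = "\<lambda>(T', m). {n. m \<le> n \<and> (\<forall>\<beta>\<in>T'. D n \<inter> a \<beta> \<inter> {m..} \<noteq> {})}"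
  have ne: "?I \<noteq> {}"
    by auto
  have base: "\<exists>k\<in>?I. principal (?B k) \<le> inf (principal (?B i)) (principal (?B j))" if ij: "i \<in> ?I" "j \<in> ?I" for i j
  proof -
    obtain T1 m1 T2 m2 where i: "i = (T1, m1)" and j: "j = (T2, m2)"
      by fastforce
    have "?B (T1 \<union> T2, max m1 m2) \<subseteq> ?B i \<inter> ?B j"
      unfolding i j by fastforce
    moreover have "(T1 \<union> T2, max m1 m2) \<in> ?I"
      using ij i j by auto
    ultimately show ?thesis
      unfolding inf_principal principal_le_iff by (rule bexI)
  qed
  have "eventually P (trace_filter D T) \<longleftrightarrow> (\<exists>i\<in>?I. eventually P (principal (?B i)))"
    unfolding trace_filter_def using eventually_INF_base[OF ne base] by (simp add: case_prod_unfold)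
  also have "\<dots> \<longleftrightarrow> (\<exists>T' m. finite T' \<and> T' \<subseteq> T \<and>
     (\<forall>n\<ge>m. (\<forall>\<beta>\<in>T'. D n \<inter> a \<beta> \<inter> {m..} \<noteq> {}) \<longrightarrow> P n))"
    by (simp add: Bex_def eventually_principal imp_conjL)
  finally show ?thesis .
qed

lemma trace_filter_bot_iff:
  "trace_filter D T = bot \<longleftrightarrow> (\<exists>T' m. finite T' \<and> T' \<subseteq> T \<and>
     (\<forall>n\<ge>m. \<exists>\<beta>\<in>T'. D n \<inter> a \<beta> \<inter> {m..} = {}))"
  unfolding trivial_limit_def eventually_trace_filter by simp

lemma trace_filter_nonbotI:
  assumes "\<And>T' m. finite T' \<Longrightarrow> T' \<subseteq> T \<Longrightarrow> \<exists>n\<ge>m. \<forall>\<beta>\<in>T'. D n \<inter> a \<beta> \<inter> {m..} \<noteq> {}"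
  shows "trace_filter D T \<noteq> bot"
  unfolding trace_filter_bot_iff using assms by meson

lemma trace_filter_nonbotD:
  assumes "trace_filter D T \<noteq> bot" "finite T'" "T' \<subseteq> T"
  shows "\<exists>n\<ge>m. \<forall>\<beta>\<in>T'. D n \<inter> a \<beta> \<inter> {m..} \<noteq> {}"
proof (rule ccontr)
  assume "\<not> ?thesis"
  then have "\<forall>n\<ge>m. \<exists>\<beta>\<in>T'. D n \<inter> a \<beta> \<inter> {m..} = {}"
    by simp
  with assms(2,3) have "trace_filter D T = bot"
    unfolding trace_filter_bot_iff by (intro exI[of _ T'] exI[of _ m]) simp
  with assms(1) show False ..
qed

lemma exists_Vietoris_limit:
  assumes fin: "\<And>n. finite (D n)"
  shows "\<exists>p K. p \<noteq> bot \<and> p \<le> sequentially \<and> closedin (Psi (range a)) K \<and>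
    (\<forall>U. openin (Psi (range a)) U \<longrightarrow> K \<subseteq> U \<longrightarrow> (\<forall>\<^sub>F n in p. Inl ` D n \<subseteq> U)) \<and>
    (\<forall>U. openin (Psi (range a)) U \<longrightarrow> K \<inter> U \<noteq> {} \<longrightarrow> (\<forall>\<^sub>F n in p. Inl ` D n \<inter> U \<noteq> {}))"
proof -
  obtain S where "\<forall>\<alpha>. \<alpha> \<in> S \<longleftrightarrow> trace_filter D (insert \<alpha> (S \<inter> {..<\<alpha>})) \<noteq> bot"
    using wellorder_greedy_set[of "\<lambda>T. trace_filter D T \<noteq> bot"] ..
  then have S: "\<alpha> \<in> S \<longleftrightarrow> trace_filter D (insert \<alpha> (S \<inter> {..<\<alpha>})) \<noteq> bot" for \<alpha>
    by (rule spec)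
  \<comment> \<open>The greedy condition at the largest element of \<open>T\<close> already covers
    all of \<open>T\<close>.\<close>
  have "\<exists>n\<ge>m. \<forall>\<beta>\<in>T. D n \<inter> a \<beta> \<inter> {m..} \<noteq> {}" if T: "finite T" "T \<subseteq> S" for T m
  proof (cases "T = {}")
    case False
    then have "Max T \<in> S"
      using Max_in[OF T(1)] T(2) by blast
    moreover have "T \<subseteq> insert (Max T) (S \<inter> {..<Max T})"
      using T(2) Max_ge[OF T(1)] by (auto simp: less_le)
    ultimately show ?thesis
      using S[of "Max T"] T(1) by (intro trace_filter_nonbotD) simp_all
  qed auto
  then have "trace_filter D S \<noteq> bot"
    by (rule trace_filter_nonbotI)
  then obtain p where p: "p \<le> trace_filter D S" "p \<noteq> bot"
    and "\<forall>P. eventually P p \<or> (\<forall>\<^sub>F n in p. \<not> P n)"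
    using ultrafilter_below by blast
  then have ultra: "eventually P p \<or> (\<forall>\<^sub>F n in p. \<not> P n)" for P
    by blast
  have contr: False if "\<forall>\<^sub>F n in p. Q n" "\<And>n. \<not> Q n" for Q
    using that p(2) by simp
  have ge: "\<forall>\<^sub>F n in p. m \<le> n" for m
    using p(1) by (rule filter_leD) (auto simp: eventually_trace_filter intro: exI[of _ "{}"])
  have pseq: "p \<le> sequentially"
    unfolding le_sequentially using ge by blast
  have inS: "\<forall>\<^sub>F n in p. D n \<inter> a \<beta> \<inter> {m..} \<noteq> {}" if "\<beta> \<in> S" for \<beta> m
    using p(1)
    by (rule filter_leD) (use that in \<open>auto simp: eventually_trace_filter intro!: exI[of _ "{\<beta>}"] exI[of _ m]\<close>)
  have notinS: "\<exists>m. \<forall>\<^sub>F n in p. D n \<inter> a \<beta> \<inter> {m..} = {}" if \<beta>: "\<beta> \<notin> S" for \<beta>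
  proof -
    from \<beta> S[of \<beta>] have "trace_filter D (insert \<beta> (S \<inter> {..<\<beta>})) = bot"
      by simp
    then obtain T m where T: "finite T" "T \<subseteq> insert \<beta> (S \<inter> {..<\<beta>})"
      "\<forall>n\<ge>m. \<exists>\<gamma>\<in>T. D n \<inter> a \<gamma> \<inter> {m..} = {}"
      unfolding trace_filter_bot_iff by (elim exE conjE)
    \<comment> \<open>All members of \<open>T\<close> except \<beta> lie in \<open>S\<close> and are
      met \<open>p\<close>-often, so the failure must occur at \<beta>.\<close>
    have "\<forall>\<^sub>F n in p. \<forall>\<gamma>\<in>T - {\<beta>}. D n \<inter> a \<gamma> \<inter> {m..} \<noteq> {}"
      using T(1,2) inS by (intro eventually_ball_finite) auto
    then have "\<forall>\<^sub>F n in p. D n \<inter> a \<beta> \<inter> {m..} = {}"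
      using ge[of m] by eventually_elim (use T(3) in blast)
    then show ?thesis ..
  qed
  define E where "E = {x. \<forall>\<^sub>F n in p. x \<in> D n}"
  define K :: "(nat + nat set) set" where "K = Inl ` E \<union> Inr ` a ` S"
  let ?Psi = "Psi (range a)"
  have "closedin ?Psi K"
    unfolding closedin_def
  proof
    show "K \<subseteq> topspace ?Psi"
      by (auto simp: K_def topspace_Psi)
    show "openin ?Psi (topspace ?Psi - K)"
    proof (rule openin_Psi_cases)
      fix b assume "Inr b \<in> topspace ?Psi - K"
      then obtain \<beta> where b: "b = a \<beta>" "\<beta> \<notin> S"
        by (auto simp: topspace_Psi K_def)
      then obtain m where m: "\<forall>\<^sub>F n in p. D n \<inter> a \<beta> \<inter> {m..} = {}"
        using notinS by blast
      have "x \<notin> E" if "x \<in> b - {..<m}" for x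
      proof
        assume "x \<in> E"
        then have "\<forall>\<^sub>F n in p. x \<in> D n \<and> D n \<inter> a \<beta> \<inter> {m..} = {}"
          using m by (simp add: E_def eventually_conj)
        then show False
          by (rule contr) (use that b in auto)
      qed
      then have "Inl ` (b - {..<m}) \<subseteq> topspace ?Psi - K"
        by (auto simp: topspace_Psi K_def)
      then show "b \<in> range a \<and> (\<exists>F. finite F \<and> Inl ` (b - F) \<subseteq> topspace ?Psi - K)"
        using b by blast
    qed
  qed
  moreover have "\<forall>\<^sub>F n in p. Inl ` D n \<subseteq> U" if U: "openin ?Psi U" "K \<subseteq> U" for U
  proof (rule ccontr)
    assume not: "\<not> (\<forall>\<^sub>F n in p. Inl ` D n \<subseteq> U)"
    define W where "W = {x. (Inl x :: nat + nat set) \<in> U}"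
    have "Inl ` D n \<subseteq> U \<longleftrightarrow> D n \<subseteq> W" for n
      by (auto simp: W_def)
    then have notW: "\<forall>\<^sub>F n in p. \<not> D n \<subseteq> W"
      using not ultra[of "\<lambda>n. D n \<subseteq> W"] by simp
    have aW: "\<exists>M. a \<beta> - W \<subseteq> {..<M}" if "\<beta> \<in> S" for \<beta>
    proof -
      have "Inr (a \<beta>) \<in> U"
        using that U(2) by (auto simp: K_def)
      then obtain F where F: "finite F" "Inl ` (a \<beta> - F) \<subseteq> U"
        using openin_Psi_Inr[OF U(1)] by metis
      have "a \<beta> - W \<subseteq> F"
        using F(2) by (auto simp: W_def)
      then show ?thesis
        using F(1) finite_nat_bounded[of F] by blast
    qed
    \<comment> \<open>For \<beta> in \<open>S\<close> the bound comes from openness of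
      \<open>U\<close>; otherwise the trace on \<open>a \<beta>\<close> is itself eventually
      bounded.\<close>
    have "\<exists>M. \<forall>\<^sub>F n in p. D n \<inter> a \<beta> - W \<subseteq> {..<M}" for \<beta>
    proof (cases "\<beta> \<in> S")
      case True
      then obtain M where "a \<beta> - W \<subseteq> {..<M}"
        using aW by blast
      then have "\<forall>n. D n \<inter> a \<beta> - W \<subseteq> {..<M}"
        by blast
      then show ?thesis
        by (meson always_eventually)
    next
      case False
      then obtain m where "\<forall>\<^sub>F n in p. D n \<inter> a \<beta> \<inter> {m..} = {}"
        using notinS by blast
      then have "\<forall>\<^sub>F n in p. D n \<inter> a \<beta> - W \<subseteq> {..<m}"
        by eventually_elim (auto simp: disjoint_iff not_le)
      then show ?thesis ..
    qed
    then obtain M where M: "\<And>\<beta>. \<forall>\<^sub>F n in p. D n \<inter> a \<beta> - W \<subseteq> {..<M \<beta>}"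
      by metis
    have hyp: "\<exists>n. (\<forall>\<beta>\<in>T \<inter> S. D n \<inter> a \<beta> \<inter> {m..} \<noteq> {}) \<and> D n \<inter> {m..} - W - (\<Union>\<beta>\<in>T. a \<beta>) \<noteq> {}"
      if T: "finite T" for T m
    proof -
      \<comment> \<open>The sum bounds every \<open>M \<beta>\<close> with \<beta> in
        \<open>T\<close> and also makes sense for empty \<open>T\<close>.\<close>
      define N where "N = m + sum M T"
      have N: "M \<beta> \<le> N" if "\<beta> \<in> T" for \<beta>
        using member_le_sum[OF that, of M] T by (simp add: N_def)
      \<comment> \<open>Points outside \<open>W\<close> are outside \<open>E\<close>, so the
        ultrafilter pushes \<open>D n - W\<close> beyond \<open>N\<close>, hence out of every
        \<open>a \<beta>\<close> with \<beta> in \<open>T\<close>.\<close>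
      have "\<forall>\<^sub>F n in p. x \<notin> D n" if "x \<notin> W" for x
      proof -
        have "x \<notin> E"
          using that U(2) by (auto simp: W_def K_def)
        then show ?thesis
          using ultra[of "\<lambda>n. x \<in> D n"] by (simp add: E_def)
      qed
      then have "\<forall>\<^sub>F n in p. \<forall>x\<in>{..<N} - W. x \<notin> D n"
        by (intro eventually_ball_finite) auto
      moreover have "\<forall>\<^sub>F n in p. \<forall>\<beta>\<in>T. D n \<inter> a \<beta> - W \<subseteq> {..<M \<beta>}"
        using T M by (intro eventually_ball_finite) auto
      moreover have "\<forall>\<^sub>F n in p. \<forall>\<beta>\<in>T \<inter> S. D n \<inter> a \<beta> \<inter> {m..} \<noteq> {}"
        using T inS by (intro eventually_ball_finite) auto
      ultimately have "\<forall>\<^sub>F n in p. (\<forall>\<beta>\<in>T \<inter> S. D n \<inter> a \<beta> \<inter> {m..} \<noteq> {}) \<and>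
        D n \<inter> {m..} - W - (\<Union>\<beta>\<in>T. a \<beta>) \<noteq> {}"
        using notW
      proof eventually_elim
        case (elim n)
        then obtain x where x: "x \<in> D n" "x \<notin> W"
          by blast
        then have "N \<le> x"
          using elim(1) by (meson Diff_iff lessThan_iff not_le)
        moreover have "x \<notin> a \<beta>" if "\<beta> \<in> T" for \<beta>
        proof
          assume "x \<in> a \<beta>"
          then have "x < M \<beta>"
            using elim(2) that x by blast
          then show False
            using N[OF that] \<open>N \<le> x\<close> by simp
        qed
        ultimately have "x \<in> D n \<inter> {m..} - W - (\<Union>\<beta>\<in>T. a \<beta>)"
          using x by (simp add: N_def)
        then show ?case
          using elim(3) by blast
      qed
      then show ?thesis
        using p(2) eventually_happens by blast
    qed
    obtain \<alpha> where hit: "\<And>T m. finite T \<Longrightarrow> T \<subseteq> {..<\<alpha>} \<Longrightarrow>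
        \<exists>n. (\<forall>\<beta>\<in>T \<inter> S. D n \<inter> a \<beta> \<inter> {m..} \<noteq> {}) \<and> D n \<inter> a \<alpha> \<inter> {m..} - W \<noteq> {}"
      using guess[of S D W] hyp by meson
    have "\<exists>n\<ge>m. \<forall>\<beta>\<in>T. D n \<inter> a \<beta> \<inter> {m..} \<noteq> {}"
      if T: "finite T" "T \<subseteq> insert \<alpha> (S \<inter> {..<\<alpha>})" for T m
    proof -
      \<comment> \<open>Finiteness of the early terms: a \<open>D n\<close> with a point beyond
        \<open>M\<close> must have index at least \<open>m\<close>.\<close>
      have "finite (\<Union>n<m. D n)"
        using fin by simp
      then obtain M where M: "(\<Union>n<m. D n) \<subseteq> {..<M}"
        using finite_nat_bounded by blast
      have "finite (T - {\<alpha>})" "T - {\<alpha>} \<subseteq> {..<\<alpha>}" "(T - {\<alpha>}) \<inter> S = T - {\<alpha>}"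
        using T by auto
      with hit[of "T - {\<alpha>}" "max m M"] obtain n where
        n: "\<forall>\<beta>\<in>T - {\<alpha>}. D n \<inter> a \<beta> \<inter> {max m M..} \<noteq> {}" "D n \<inter> a \<alpha> \<inter> {max m M..} - W \<noteq> {}"
        by auto
      have "m \<le> n"
      proof (rule ccontr)
        assume "\<not> m \<le> n"
        then have "D n \<subseteq> (\<Union>n<m. D n)"
          by (intro UN_upper) simp
        then have "D n \<subseteq> {..<M}"
          using M by (rule order_trans)
        with n(2) show False
          by auto
      qed
      moreover have "D n \<inter> a \<beta> \<inter> {m..} \<noteq> {}" if "\<beta> \<in> T" for \<beta>
      proof -
        have "D n \<inter> a \<beta> \<inter> {max m M..} \<noteq> {}"
          using n that by (cases "\<beta> = \<alpha>") auto
        then show ?thesis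
          by auto
      qed
      ultimately show ?thesis
        by blast
    qed
    then have "\<alpha> \<in> S"
      unfolding S by (rule trace_filter_nonbotI)
    then obtain M where "a \<alpha> - W \<subseteq> {..<M}"
      using aW by blast
    \<comment> \<open>Membership in \<open>S\<close> bounds \<open>a \<alpha> - W\<close> by
      \<open>M\<close>, but the guess provides a point of it beyond \<open>M\<close>.\<close>
    then show False
      using hit[of "{}" M] by fastforce
  qed
  moreover have "\<forall>\<^sub>F n in p. Inl ` D n \<inter> U \<noteq> {}" if U: "openin ?Psi U" "K \<inter> U \<noteq> {}" for U
  proof -
    from U(2) consider x where "x \<in> E" "Inl x \<in> U" | \<beta> where "\<beta> \<in> S" "Inr (a \<beta>) \<in> U"
      by (auto simp: K_def)
    then show ?thesis
    proof cases
      case 1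
      then have "\<forall>\<^sub>F n in p. x \<in> D n"
        by (simp add: E_def)
      then show ?thesis
        by eventually_elim (use 1 in blast)
    next
      case 2
      then obtain F where F: "finite F" "Inl ` (a \<beta> - F) \<subseteq> U"
        using openin_Psi_Inr[OF U(1)] by metis
      obtain m where m: "F \<subseteq> {..<m}"
        using finite_nat_bounded[OF F(1)] by blast
      show ?thesis
        using inS[OF 2(1), of m]
      proof eventually_elim
        case (elim n)
        then obtain x where "x \<in> D n" "x \<in> a \<beta>" "m \<le> x"
          by auto
        then have "Inl x \<in> Inl ` D n \<inter> U"
          using F(2) m by fastforce
        then show ?case
          by blast
      qed
    qed
  qed
  ultimately show ?thesis
    using p(2) pseq by (intro exI[of _ p] exI[of _ K]) simp
qed

section \<open>Pseudocompactness and maximality of the family\<close>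

lemma pseudocompact_family_range: "pseudocompact_family (range a)"
  unfolding pseudocompact_family_def
proof (rule pseudocompact_Vietoris_Psi)
  show "\<forall>b\<in>range a. infinite b"
    using infinite_a by blast
qed (rule exists_Vietoris_limit)

text \<open>Maximality is the guessing property for singletons \<open>D n = {n}\<close>, with
  \<open>S\<close> empty and \<open>W\<close> the complement of a supposed new member
  \<open>b\<close>: some \<open>a \<alpha>\<close> then meets \<open>b\<close> in an infinite
  set.\<close>

lemma MAD_family_range: "MAD_family (range a)"
  unfolding MAD_family_def
proof
  show "almost_disjoint_family (range a)"
    unfolding almost_disjoint_family_def
  proof (intro conjI ballI impI)
    show "infinite (range a)"
      using uncountable_infinite[OF uncountable_omega1] by (simp add: finite_image_iff[OF inj_a])
  next
    fix b c assume "b \<in> range a" "c \<in> range a" "b \<noteq> c"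
    then obtain \<beta> \<gamma> where "b = a \<beta>" "c = a \<gamma>" "\<beta> \<noteq> \<gamma>"
      by blast
    then show "finite (b \<inter> c)"
      by (simp add: almost_disjoint_a)
  qed (use infinite_a in blast)
  show "\<not> (\<exists>B. almost_disjoint_family B \<and> range a \<subset> B)"
  proof
    assume "\<exists>B. almost_disjoint_family B \<and> range a \<subset> B"
    then obtain B b where "almost_disjoint_family B" "range a \<subseteq> B" "b \<in> B" "b \<notin> range a"
      by blast
    then have b: "infinite b" and "\<forall>c\<in>range a. finite (b \<inter> c)"
      unfolding almost_disjoint_family_def by (simp, metis subsetD)
    then have fin: "finite (b \<inter> a \<alpha>)" for \<alpha>
      by blast
    have hyp: "\<exists>n. (\<forall>\<beta>\<in>T \<inter> {}. {n} \<inter> a \<beta> \<inter> {m..} \<noteq> {}) \<and> {n} \<inter> {m..} - (- b) - (\<Union>\<beta>\<in>T. a \<beta>) \<noteq> {}"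
      if "finite T" for T m
    proof -
      have "finite (\<Union>\<beta>\<in>T. b \<inter> a \<beta>)"
        using that fin by blast
      then have "infinite (b - (\<Union>\<beta>\<in>T. b \<inter> a \<beta>))"
        using b by (rule Diff_infinite_finite)
      then obtain n where "m \<le> n" "n \<in> b - (\<Union>\<beta>\<in>T. b \<inter> a \<beta>)"
        unfolding infinite_nat_iff_unbounded_le by blast
      then show ?thesis
        by (intro exI[of _ n]) auto
    qed
    obtain \<alpha> where "\<And>T m. finite T \<Longrightarrow> T \<subseteq> {..<\<alpha>} \<Longrightarrow>
        \<exists>n. (\<forall>\<beta>\<in>T \<inter> {}. {n} \<inter> a \<beta> \<inter> {m..} \<noteq> {}) \<and> {n} \<inter> a \<alpha> \<inter> {m..} - (- b) \<noteq> {}"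
      using guess[of "{}" "\<lambda>n. {n}" "- b"] hyp by meson
    from this[of "{}"] have "\<exists>n\<ge>m. n \<in> b \<inter> a \<alpha>" for m
      by fastforce
    then have "infinite (b \<inter> a \<alpha>)"
      unfolding infinite_nat_iff_unbounded_le by blast
    with fin show False
      by blast
  qed
qed

end

theorem theorem6:
  assumes "diamond_b"
  shows "\<exists>A. MAD_family A \<and> A \<approx> (UNIV :: omega1 set) \<and> pseudocompact_family A"
proof -
  obtain a where "guessing_family a"
    using diamond_b_guessing_family[OF assms] .
  then interpret guessing_family a .
  have "range a \<approx> (UNIV :: omega1 set)"
    using inj_a by (rule inj_on_image_eqpoll_self)
  then show ?thesis
    using MAD_family_range pseudocompact_family_range by blast
qed

end
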